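(* Let $l\approx r$ be a unit clause, $\theta$ a substitution, and $C[l\theta]$ a clause containing an occurrence of the term $l\theta$; let $C[l\theta\mapsto r\theta]$ be the clause obtained by replacing this occurrence by $r\theta$. Suppose $l\theta\succ_t r\theta$ and either $\{l\theta\approx r\theta\}\prec_c C[l\theta]$ or $l\theta\sqsupset l$. Then (soundness) $C[l\theta\mapsto r\theta]$ is a logical consequence of $l\approx r$ and $C[l\theta]$, and (admissibility) $C[l\theta]$ is closure redundant in $\{l\approx r,\ C[l\theta\mapsto r\theta]\}$.
   Context: Fix a first-order signature with equality as the only predicate. A literal is an unordered pair of terms with a polarity ($s\approx t$ or $s\not\approx t$); a clause is a finite multiset of literals. $id$ is the identity substitution. Fix a reduction ordering $\succ_t$ on terms (well-founded, closed under substitutions and contexts), total on ground terms. For an ordering $\succ$, its multiset extension $\succ\!\succ$: $A\succ\!\succ B$ iff $A\ne B$ and for every $x$ with $B(x)>A(x)$ there is $y\succ x$ with $A(y)>B(y)$. $L\succ_l L'$ iff $M_l(L)\succ\!\succ_t M_l(L')$ with $M_l(s\approx t)=\{s,t\}$, $M_l(s\not\approx t)=\{s,s,t,t\}$; $C\succ_c D$ iff $C\succ\!\succ_l D$. $s\sqsupset t$ ($s$ less general than $t$) means $t\sigma=s$ for some $\sigma$ but no $\rho$ has $s\rho=t$. A closure $\langle e,\sigma\rangle$ (expression $e$, substitution $\sigma$) represents $e\sigma$; it is ground if $e\sigma$ is ground. On ground term closures, $\langle s,\sigma\rangle\succ_{tc}\langle t,\rho\rangle$ iff $s\sigma\succ_t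 t\rho$, or $s\sigma=t\rho$ and $s\sqsupset t$; this is extended to an arbitrary fixed total well-founded order, still $\succ_{tc}$. $M_{lc}(\langle s\approx t,\theta\rangle)=\{\langle s,\theta\rangle,\langle t,\theta\rangle\}$, $M_{lc}(\langle s\not\approx t,\theta\rangle)=\{\langle s,\theta\rangle,\langle s\theta,id\rangle,\langle t,\theta\rangle,\langle t\theta,id\rangle\}$, $\langle L,\sigma\rangle\succ_{lc}\langle L',\rho\rangle$ iff $M_{lc}(\cdot)\succ\!\succ_{tc}M_{lc}(\cdot)$. $M_{cc}(\langle C,\sigma\rangle)=\{\langle L,\sigma\rangle\}$ if $C=\{L\}$, else $\{\langle L\sigma,id\rangle\mid L\in C\}$; $\langle C,\sigma\rangle\succ_{cc}\langle D,\rho\rangle$ iff $M_{cc}(\cdot)\succ\!\succ_{lc}M_{cc}(\cdot)$. A clause $C$ is closure redundant in a set $S$ of clauses if for every ground closure $\langle C,\theta\rangle$ (i.e. $C\theta$ ground) there is a set $G$ of ground closures $\langle D,\rho\rangle$ with $D\in S$, such that the ground clauses represented by $G$ entail $C\theta$ and every element of $G$ is $\prec_{cc}\langle C,\theta\rangle$.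
   Formalization: Closures are taken up to renaming of variables and up to values of the substitution outside the expression, and the total closure ordering is on these classes; for raw pairs the claim fails, e.g. f(x)≈a, θ={x↦y}, C=f(y)≈b. *)

theory Defs
  imports "HOL-Library.Multiset_Order" "HOL-Library.Uprod"
begin

section \<open>Terms, literals, clauses\<close>

datatype ('f, vars_trm: 'v) trm = Var 'v | Fun 'f "('f, 'v) trm list"

type_synonym ('f, 'v) subst = "'v \<Rightarrow> ('f, 'v) trm"

text \<open>The signature is a set \<open>F\<close> of function symbols paired with their arities.\<close>

inductive_set trms :: "('f \<times> nat) set \<Rightarrow> ('f, 'v) trm set" for F where
  Var: "Var x \<in> trms F"
| Fun: "(f, length ts) \<in> F \<Longrightarrow> \<forall>t\<in>set ts. t \<in> trms F \<Longrightarrow> Fun f ts \<in> trms F"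

definition is_subst :: "('f \<times> nat) set \<Rightarrow> ('f, 'v) subst \<Rightarrow> bool" where
  "is_subst F \<sigma> \<longleftrightarrow> range \<sigma> \<subseteq> trms F"

primrec subst_trm :: "('f, 'v) trm \<Rightarrow> ('f, 'v) subst \<Rightarrow> ('f, 'v) trm" (infixl \<open>\<cdot>\<close> 67) where
  "Var x \<cdot> \<sigma> = \<sigma> x"
| "Fun f ts \<cdot> \<sigma> = Fun f (map (\<lambda>t. t \<cdot> \<sigma>) ts)"

definition ground_trms :: "('f \<times> nat) set \<Rightarrow> ('f, 'v) trm set" where
  "ground_trms F = {t \<in> trms F. vars_trm t = {}}"

datatype 'a lit = Pos "'a uprod" | Neg "'a uprod"

abbreviation eq_lit :: "'a \<Rightarrow> 'a \<Rightarrow> 'a lit" (infix \<open>\<approx>\<close> 60) where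
  "s \<approx> t \<equiv> Pos (Upair s t)"

abbreviation neq_lit :: "'a \<Rightarrow> 'a \<Rightarrow> 'a lit" (infix \<open>\<napprox>\<close> 60) where
  "s \<napprox> t \<equiv> Neg (Upair s t)"

definition subst_lit :: "('f, 'v) trm lit \<Rightarrow> ('f, 'v) subst \<Rightarrow> ('f, 'v) trm lit" (infixl \<open>\<cdot>l\<close> 67) where
  "L \<cdot>l \<sigma> = map_lit (\<lambda>t. t \<cdot> \<sigma>) L"

definition vars_lit :: "('f, 'v) trm lit \<Rightarrow> 'v set" where
  "vars_lit L = (\<Union>t\<in>set_lit L. vars_trm t)"

type_synonym ('f, 'v) clause = "('f, 'v) trm lit multiset"

definition subst_cls :: "('f, 'v) clause \<Rightarrow> ('f, 'v) subst \<Rightarrow> ('f, 'v) clause" (infixl \<open>\<cdot>c\<close> 67) where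
  "C \<cdot>c \<sigma> = image_mset (\<lambda>L. L \<cdot>l \<sigma>) C"

definition vars_cls :: "('f, 'v) clause \<Rightarrow> 'v set" where
  "vars_cls C = (\<Union>L\<in>set_mset C. vars_lit L)"

definition clauses :: "('f \<times> nat) set \<Rightarrow> ('f, 'v) clause set" where
  "clauses F = {C. \<forall>L\<in>#C. set_lit L \<subseteq> trms F}"

datatype ('f, 'v) ctxt = Hole | More 'f "('f, 'v) trm list" "('f, 'v) ctxt" "('f, 'v) trm list"

primrec plug :: "('f, 'v) ctxt \<Rightarrow> ('f, 'v) trm \<Rightarrow> ('f, 'v) trm" where
  "plug Hole s = s"
| "plug (More f us K vs) s = Fun f (us @ plug K s # vs)"

text \<open>\<open>replace_in_cls u v C C'\<close>: \<open>C'\<close> arises from \<open>C\<close> by replacing exactly one occurrence of \<open>u\<close> by \<open>v\<close>.\<close>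

inductive replace_in_lit ::
  "('f, 'v) trm \<Rightarrow> ('f, 'v) trm \<Rightarrow> ('f, 'v) trm lit \<Rightarrow> ('f, 'v) trm lit \<Rightarrow> bool" for u v where
  "replace_in_lit u v (plug K u \<approx> t) (plug K v \<approx> t)"
| "replace_in_lit u v (plug K u \<napprox> t) (plug K v \<napprox> t)"

inductive replace_in_cls ::
  "('f, 'v) trm \<Rightarrow> ('f, 'v) trm \<Rightarrow> ('f, 'v) clause \<Rightarrow> ('f, 'v) clause \<Rightarrow> bool" for u v where
  "replace_in_lit u v L L' \<Longrightarrow> replace_in_cls u v (add_mset L D) (add_mset L' D)"


section \<open>Logical consequence\<close>

primrec eval :: "('f \<Rightarrow> 'u list \<Rightarrow> 'u) \<Rightarrow> ('v \<Rightarrow> 'u) \<Rightarrow> ('f, 'v) trm \<Rightarrow> 'u" where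
  "eval I \<alpha> (Var x) = \<alpha> x"
| "eval I \<alpha> (Fun f ts) = I f (map (eval I \<alpha>) ts)"

definition is_structure :: "('f \<times> nat) set \<Rightarrow> 'u set \<Rightarrow> ('f \<Rightarrow> 'u list \<Rightarrow> 'u) \<Rightarrow> bool" where
  "is_structure F D I \<longleftrightarrow> D \<noteq> {} \<and>
     (\<forall>(f, n)\<in>F. \<forall>us. length us = n \<longrightarrow> set us \<subseteq> D \<longrightarrow> I f us \<in> D)"

text \<open>\<^const>\<open>proper_uprod\<close> says that the two components of an unordered pair differ.\<close>

definition lit_true :: "('f \<Rightarrow> 'u list \<Rightarrow> 'u) \<Rightarrow> ('v \<Rightarrow> 'u) \<Rightarrow> ('f, 'v) trm lit \<Rightarrow> bool" where
  "lit_true I \<alpha> L \<longleftrightarrow>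
     (case L of Pos p \<Rightarrow> \<not> proper_uprod (map_uprod (eval I \<alpha>) p)
              | Neg p \<Rightarrow> proper_uprod (map_uprod (eval I \<alpha>) p))"

definition cls_true :: "'u set \<Rightarrow> ('f \<Rightarrow> 'u list \<Rightarrow> 'u) \<Rightarrow> ('f, 'v) clause \<Rightarrow> bool" where
  "cls_true D I C \<longleftrightarrow> (\<forall>\<alpha>. range \<alpha> \<subseteq> D \<longrightarrow> (\<exists>L\<in>#C. lit_true I \<alpha> L))"

text \<open>A definition cannot quantify over the type from which carriers of structures are taken. Here
  carriers are nonempty sets of terms; by \<open>entails_any_universe\<close> below this loses no generality.\<close>

definition entails :: "('f \<times> nat) set \<Rightarrow> ('f, 'v) clause set \<Rightarrow> ('f, 'v) clause \<Rightarrow> bool" where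
  "entails F N C \<longleftrightarrow>
     (\<forall>(D :: ('f, 'v) trm set) I.
        is_structure F D I \<longrightarrow> (\<forall>E\<in>N. cls_true D I E) \<longrightarrow> cls_true D I C)"

lemma lit_true_eq [simp]:
  "lit_true I \<alpha> (s \<approx> t) \<longleftrightarrow> eval I \<alpha> s = eval I \<alpha> t"
  "lit_true I \<alpha> (s \<napprox> t) \<longleftrightarrow> eval I \<alpha> s \<noteq> eval I \<alpha> t"
  by (simp_all add: lit_true_def)

lemma lit_exhaust:
  obtains s t where "L = s \<approx> t" | s t where "L = s \<napprox> t"
  by (metis lit.exhaust uprod_exhaust)

lemma eval_in_structure:
  assumes "is_structure F D I" "range \<alpha> \<subseteq> D" "t \<in> trms F"
  shows "eval I \<alpha> t \<in> D"
  using assms(3)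
proof induction
  case (Var x)
  then show ?case using assms(2) by auto
next
  case (Fun f ts)
  then have "set (map (eval I \<alpha>) ts) \<subseteq> D" by auto
  with Fun assms(1) show ?case unfolding is_structure_def by fastforce
qed

lemma entails_any_universe:
  fixes F :: "('f \<times> nat) set" and N :: "('f, 'v) clause set" and D :: "'u set"
  assumes ent: "entails F N C" and N: "N \<subseteq> clauses F" and C: "C \<in> clauses F"
    and S: "is_structure F D I" and mod: "\<forall>E\<in>N. cls_true D I E"
  shows "cls_true D I C"
  unfolding cls_true_def
proof (intro allI impI, rule ccontr)
  fix \<alpha> :: "'v \<Rightarrow> 'u"
  assume \<alpha>: "range \<alpha> \<subseteq> D" and cex: "\<not> (\<exists>L\<in>#C. lit_true I \<alpha> L)"
  define T where "T = (trms F :: ('f, 'v) trm set)"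
  define h where "h = eval I \<alpha>"
  define e where "e u = (SOME t. t \<in> T \<and> h t = u)" for u
  define D' where "D' = e ` h ` T"
  define J where "J f us = e (I f (map h us))" for f us
  have e: "e (h t) \<in> T" "h (e (h t)) = h t" if "t \<in> T" for t
    using someI[of "\<lambda>s. s \<in> T \<and> h s = h t" t] that by (auto simp: e_def)
  have D': "t \<in> T" "e (h t) = t" if "t \<in> D'" for t
    using that e by (auto simp: D'_def)
  have S': "is_structure F D' J"
    unfolding is_structure_def
  proof safe
    assume "D' = {}"
    then have "(trms F :: ('f, 'v) trm set) = {}" by (simp add: D'_def T_def)
    moreover have "(Var undefined :: ('f, 'v) trm) \<in> trms F" by (rule trms.Var)
    ultimately show False by simp
  next
    fix f us assume f: "(f, length us) \<in> F" and us: "set us \<subseteq> D'"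
    have "Fun f us \<in> T"
      unfolding T_def using f us D'(1) T_def by (auto intro!: trms.Fun)
    moreover have "J f us = e (h (Fun f us))"
      by (simp add: J_def h_def)
    ultimately show "J f us \<in> D'" by (auto simp: D'_def)
  qed
  have ev: "eval J \<beta> t = e (eval I (\<lambda>x. h (\<beta> x)) t) \<and> eval I (\<lambda>x. h (\<beta> x)) t \<in> h ` T"
    if \<beta>: "range \<beta> \<subseteq> D'" and t: "t \<in> T" for \<beta> t
    using t unfolding T_def
  proof induction
    case (Var x)
    have "\<beta> x \<in> D'" using \<beta> by auto
    then show ?case using D'[of "\<beta> x"] by (auto simp: T_def[symmetric])
  next
    case (Fun f ts)
    define us where "us = map (\<lambda>t. e (eval I (\<lambda>x. h (\<beta> x)) t)) ts"
    have e': "e a \<in> T \<and> h (e a) = a" if "a \<in> h ` T" for a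
      using that e by blast
    have img: "eval I (\<lambda>x. h (\<beta> x)) t \<in> h ` T" if "t \<in> set ts" for t
      using Fun(2) that unfolding T_def by blast
    have us: "set us \<subseteq> T" "map h us = map (eval I (\<lambda>x. h (\<beta> x))) ts"
      using e'[OF img] by (auto simp: us_def)
    have "Fun f us \<in> T" using us(1) Fun(1) by (auto simp: T_def us_def intro!: trms.Fun)
    moreover have "h (Fun f us) = I f (map (eval I (\<lambda>x. h (\<beta> x))) ts)"
      using us(2) by (simp add: h_def)
    moreover have "eval J \<beta> (Fun f ts) = e (I f (map (eval I (\<lambda>x. h (\<beta> x))) ts))"
    proof -
      have "map (eval J \<beta>) ts = us" using Fun(2) by (auto simp: us_def)
      then show ?thesis using us(2) by (simp add: J_def)
    qed
    ultimately show ?case by (metis T_def eval.simps(2) image_eqI)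
  qed
  have inj: "e a = e b \<longleftrightarrow> a = b" if "a \<in> h ` T" "b \<in> h ` T" for a b
    using that e(2) by (metis imageE)
  have lit: "lit_true J \<beta> L \<longleftrightarrow> lit_true I (\<lambda>x. h (\<beta> x)) L"
    if "range \<beta> \<subseteq> D'" "set_lit L \<subseteq> T" for \<beta> L
    using that ev[OF that(1)] inj by (cases L rule: lit_exhaust) auto
  have "cls_true D' J E" if "E \<in> N" for E
    unfolding cls_true_def
  proof (intro allI impI)
    fix \<beta> :: "'v \<Rightarrow> ('f, 'v) trm" assume \<beta>: "range \<beta> \<subseteq> D'"
    have "h (\<beta> x) \<in> D" for x
      using eval_in_structure[OF S \<alpha>, of "\<beta> x"] \<beta> D'(1) unfolding h_def T_def by blast
    then have "range (\<lambda>x. h (\<beta> x)) \<subseteq> D" by auto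
    with mod that obtain L where "L \<in># E" "lit_true I (\<lambda>x. h (\<beta> x)) L"
      unfolding cls_true_def by blast
    moreover have "set_lit L \<subseteq> T" using \<open>L \<in># E\<close> that N by (auto simp: clauses_def T_def)
    ultimately show "\<exists>L\<in>#E. lit_true J \<beta> L" using lit[OF \<beta>] by blast
  qed
  then have CJ: "cls_true D' J C" using ent S' unfolding entails_def by blast
  define \<beta> where "\<beta> x = e (h (Var x))" for x
  have VT: "Var x \<in> T" for x by (simp add: T_def trms.Var)
  have "h (\<beta> x) = \<alpha> x" for x
    unfolding \<beta>_def e(2)[OF VT] by (simp add: h_def)
  moreover have "range \<beta> \<subseteq> D'"
    using VT by (auto simp: \<beta>_def D'_def)
  ultimately have \<beta>: "range \<beta> \<subseteq> D'" "(\<lambda>x. h (\<beta> x)) = \<alpha>" by auto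
  with CJ obtain L where "L \<in># C" "lit_true J \<beta> L" unfolding cls_true_def by blast
  then show False using lit[OF \<beta>(1)] \<beta>(2) cex C by (auto simp: clauses_def T_def)
qed


section \<open>Orderings on terms, literals and clauses\<close>

text \<open>Orderings are written as \<open>gt s t\<close> for \<open>s \<succ> t\<close>, whereas \<^const>\<open>multp\<^sub>H\<^sub>O\<close> and \<^const>\<open>wfp_on\<close>
  expect the smaller element first.\<close>

definition multiset_gt :: "('a \<Rightarrow> 'a \<Rightarrow> bool) \<Rightarrow> 'a multiset \<Rightarrow> 'a multiset \<Rightarrow> bool" where
  "multiset_gt gt A B \<longleftrightarrow> multp\<^sub>H\<^sub>O gt\<inverse>\<inverse> B A"

lemma multiset_gt_iff:
  "multiset_gt gt A B \<longleftrightarrow>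
     A \<noteq> B \<and> (\<forall>x. count B x > count A x \<longrightarrow> (\<exists>y. gt y x \<and> count A y > count B y))"
  by (auto simp: multiset_gt_def multp\<^sub>H\<^sub>O_def)

definition reduction_ordering ::
  "('f \<times> nat) set \<Rightarrow> (('f, 'v) trm \<Rightarrow> ('f, 'v) trm \<Rightarrow> bool) \<Rightarrow> bool" where
  "reduction_ordering F gt \<longleftrightarrow>
     transp_on (trms F) gt \<and> wfp_on (trms F) gt\<inverse>\<inverse> \<and>
     (\<forall>s\<in>trms F. \<forall>t\<in>trms F. \<forall>\<sigma>. is_subst F \<sigma> \<longrightarrow> gt s t \<longrightarrow> gt (s \<cdot> \<sigma>) (t \<cdot> \<sigma>)) \<and>
     (\<forall>s\<in>trms F. \<forall>t\<in>trms F. \<forall>K. plug K s \<in> trms F \<longrightarrow> gt s t \<longrightarrow> gt (plug K s) (plug K t))"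

lift_definition mset_uprod :: "'a uprod \<Rightarrow> 'a multiset" is "\<lambda>(a, b). {#a, b#}"
  by (auto simp: add_mset_commute)

lemma mset_uprod_Upair [simp]: "mset_uprod (Upair a b) = {#a, b#}"
  by transfer simp

lemma mset_uprod_map [simp]: "mset_uprod (map_uprod f p) = image_mset f (mset_uprod p)"
  by (cases p) simp

fun M_l :: "('f, 'v) trm lit \<Rightarrow> ('f, 'v) trm multiset" where
  "M_l (Pos p) = mset_uprod p"
| "M_l (Neg p) = mset_uprod p + mset_uprod p"

definition lit_gt :: "(('f, 'v) trm \<Rightarrow> ('f, 'v) trm \<Rightarrow> bool) \<Rightarrow>
    ('f, 'v) trm lit \<Rightarrow> ('f, 'v) trm lit \<Rightarrow> bool" where
  "lit_gt gt L L' \<longleftrightarrow> multiset_gt gt (M_l L) (M_l L')"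

definition cls_gt :: "(('f, 'v) trm \<Rightarrow> ('f, 'v) trm \<Rightarrow> bool) \<Rightarrow>
    ('f, 'v) clause \<Rightarrow> ('f, 'v) clause \<Rightarrow> bool" where
  "cls_gt gt C D \<longleftrightarrow> multiset_gt (lit_gt gt) C D"

definition less_general :: "('f, 'v) trm \<Rightarrow> ('f, 'v) trm \<Rightarrow> bool" (infix \<open>\<sqsupset>\<close> 50) where
  "s \<sqsupset> t \<longleftrightarrow> (\<exists>\<sigma>. t \<cdot> \<sigma> = s) \<and> \<not> (\<exists>\<rho>. s \<cdot> \<rho> = t)"


section \<open>Closures\<close>

text \<open>Closures are identified up to renaming of variables and up to the values of the substitution
  on variables not occurring in the expression. Without this identification, variants such as
  \<open>\<langle>f(x), {x \<mapsto> a}\<rangle>\<close> and \<open>\<langle>f(y), {y \<mapsto> a}\<rangle>\<close> would be distinct, and a total ordering of closures would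
  have to order them arbitrarily.\<close>

definition variant :: "('e \<Rightarrow> ('f, 'v) subst \<Rightarrow> 'e) \<Rightarrow> ('e \<Rightarrow> 'v set) \<Rightarrow>
    'e \<times> ('f, 'v) subst \<Rightarrow> 'e \<times> ('f, 'v) subst \<Rightarrow> bool" where
  "variant app vars = (\<lambda>(e, \<sigma>) (e', \<sigma>'). \<exists>\<pi>. bij \<pi> \<and>
     app e (\<lambda>x. Var (\<pi> x)) = e' \<and> (\<forall>x\<in>vars e. \<sigma> x = \<sigma>' (\<pi> x)))"

lemma equivp_variant:
  assumes id: "\<And>e. app e Var = e"
    and comp: "\<And>e \<pi> \<pi>'. app (app e (\<lambda>x. Var (\<pi> x))) (\<lambda>x. Var (\<pi>' x)) = app e (\<lambda>x. Var (\<pi>' (\<pi> x)))"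
    and vars: "\<And>e \<pi>. vars (app e (\<lambda>x. Var (\<pi> x))) = \<pi> ` vars e"
  shows "equivp (variant app vars)"
proof (rule equivpI)
  show "reflp (variant app vars)"
    by (rule reflpI) (auto simp: variant_def id intro!: exI[of _ "\<lambda>x. x"] bij_id[unfolded id_def])
  show "symp (variant app vars)"
  proof (rule sympI)
    fix c d assume "variant app vars c d"
    then obtain e \<sigma> \<sigma>' \<pi> where c: "c = (e, \<sigma>)" "d = (app e (\<lambda>x. Var (\<pi> x)), \<sigma>')"
      and \<pi>: "bij \<pi>" "\<forall>x\<in>vars e. \<sigma> x = \<sigma>' (\<pi> x)"
      by (auto simp: variant_def)
    from \<pi>(1) have "bij (inv \<pi>)" "\<And>x. inv \<pi> (\<pi> x) = x"
      by (auto simp: bij_imp_bij_inv bij_is_inj)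
    then show "variant app vars d c"
      using \<pi>(2) unfolding c variant_def prod.case
      by (intro exI[of _ "inv \<pi>"]) (simp add: comp vars id)
  qed
  show "transp (variant app vars)"
  proof (rule transpI)
    fix c d b assume cd: "variant app vars c d" and db: "variant app vars d b"
    from cd obtain e \<sigma> \<sigma>' \<pi> where c: "c = (e, \<sigma>)" and d: "d = (app e (\<lambda>x. Var (\<pi> x)), \<sigma>')"
      and \<pi>: "bij \<pi>" "\<forall>x\<in>vars e. \<sigma> x = \<sigma>' (\<pi> x)"
      by (auto simp: variant_def)
    from db obtain \<sigma>'' \<pi>' where b: "b = (app (app e (\<lambda>x. Var (\<pi> x))) (\<lambda>x. Var (\<pi>' x)), \<sigma>'')"
      and \<pi>': "bij \<pi>'" "\<forall>x\<in>vars (app e (\<lambda>x. Var (\<pi> x))). \<sigma>' x = \<sigma>'' (\<pi>' x)"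
      unfolding d by (auto simp: variant_def)
    have "bij (\<lambda>x. \<pi>' (\<pi> x))" using bij_comp[OF \<pi>(1) \<pi>'(1)] by (simp add: comp_def)
    then show "variant app vars c b"
      using \<pi>(2) \<pi>'(2) unfolding c b variant_def prod.case
      by (intro exI[of _ "\<lambda>x. \<pi>' (\<pi> x)"]) (simp add: comp vars)
  qed
qed

lemma subst_trm_Var [simp]: "t \<cdot> Var = t"
  by (induction t) (simp_all add: map_idI)

lemma subst_trm_comp: "t \<cdot> \<sigma> \<cdot> \<tau> = t \<cdot> (\<lambda>x. \<sigma> x \<cdot> \<tau>)"
  by (induction t) simp_all

lemma subst_trm_cong: "(\<And>x. x \<in> vars_trm t \<Longrightarrow> \<sigma> x = \<tau> x) \<Longrightarrow> t \<cdot> \<sigma> = t \<cdot> \<tau>"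
  by (induction t) auto

lemma vars_subst_trm: "vars_trm (t \<cdot> \<sigma>) = (\<Union>x\<in>vars_trm t. vars_trm (\<sigma> x))"
  by (induction t) auto

lemma subst_lit_Var [simp]: "L \<cdot>l Var = L"
  by (simp add: subst_lit_def lit.map_ident)

lemma subst_lit_comp: "L \<cdot>l \<sigma> \<cdot>l \<tau> = L \<cdot>l (\<lambda>x. \<sigma> x \<cdot> \<tau>)"
  by (simp add: subst_lit_def lit.map_comp comp_def subst_trm_comp)

lemma vars_subst_lit: "vars_lit (L \<cdot>l \<sigma>) = (\<Union>x\<in>vars_lit L. vars_trm (\<sigma> x))"
  by (auto simp: vars_lit_def subst_lit_def lit.set_map vars_subst_trm)

quotient_type ('f, 'v) trm_closure = "('f, 'v) trm \<times> ('f, 'v) subst" / "variant subst_trm vars_trm"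
  by (rule equivp_variant) (auto simp: subst_trm_comp vars_subst_trm)

quotient_type ('f, 'v) lit_closure = "('f, 'v) trm lit \<times> ('f, 'v) subst" / "variant subst_lit vars_lit"
  by (rule equivp_variant) (auto simp: subst_lit_comp vars_subst_lit)

lift_definition tcl :: "('f, 'v) trm \<Rightarrow> ('f, 'v) subst \<Rightarrow> ('f, 'v) trm_closure" is Pair .

lift_definition lcl :: "('f, 'v) trm lit \<Rightarrow> ('f, 'v) subst \<Rightarrow> ('f, 'v) lit_closure" is Pair .

lemma tcl_eq_iff:
  "tcl s \<sigma> = tcl t \<rho> \<longleftrightarrow>
     (\<exists>\<pi>. bij \<pi> \<and> s \<cdot> (\<lambda>x. Var (\<pi> x)) = t \<and> (\<forall>x\<in>vars_trm s. \<sigma> x = \<rho> (\<pi> x)))"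
  by transfer (simp add: variant_def)

lemma lcl_eq_iff:
  "lcl L \<sigma> = lcl K \<rho> \<longleftrightarrow>
     (\<exists>\<pi>. bij \<pi> \<and> L \<cdot>l (\<lambda>x. Var (\<pi> x)) = K \<and> (\<forall>x\<in>vars_lit L. \<sigma> x = \<rho> (\<pi> x)))"
  by transfer (simp add: variant_def)

definition ground_trm_closures :: "('f \<times> nat) set \<Rightarrow> ('f, 'v) trm_closure set" where
  "ground_trm_closures F = {tcl s \<sigma> | s \<sigma>. s \<in> trms F \<and> is_subst F \<sigma> \<and> s \<cdot> \<sigma> \<in> ground_trms F}"

definition closure_ordering :: "('f \<times> nat) set \<Rightarrow> (('f, 'v) trm \<Rightarrow> ('f, 'v) trm \<Rightarrow> bool) \<Rightarrow>
    (('f, 'v) trm_closure \<Rightarrow> ('f, 'v) trm_closure \<Rightarrow> bool) \<Rightarrow> bool" where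
  "closure_ordering F gt tc_gt \<longleftrightarrow>
     transp_on (ground_trm_closures F) tc_gt \<and>
     wfp_on (ground_trm_closures F) tc_gt\<inverse>\<inverse> \<and>
     totalp_on (ground_trm_closures F) tc_gt \<and>
     (\<forall>s\<in>trms F. \<forall>t\<in>trms F. \<forall>\<sigma> \<rho>. is_subst F \<sigma> \<longrightarrow> is_subst F \<rho> \<longrightarrow>
        s \<cdot> \<sigma> \<in> ground_trms F \<longrightarrow> t \<cdot> \<rho> \<in> ground_trms F \<longrightarrow>
        gt (s \<cdot> \<sigma>) (t \<cdot> \<rho>) \<or> s \<cdot> \<sigma> = t \<cdot> \<rho> \<and> s \<sqsupset> t \<longrightarrow>
        tc_gt (tcl s \<sigma>) (tcl t \<rho>))"

fun M_lc_raw :: "('f, 'v) trm lit \<times> ('f, 'v) subst \<Rightarrow> ('f, 'v) trm_closure multiset" where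
  "M_lc_raw (Pos p, \<theta>) = image_mset (\<lambda>s. tcl s \<theta>) (mset_uprod p)"
| "M_lc_raw (Neg p, \<theta>) =
     image_mset (\<lambda>s. tcl s \<theta>) (mset_uprod p) + image_mset (\<lambda>s. tcl (s \<cdot> \<theta>) Var) (mset_uprod p)"

lemma M_lc_raw_variant:
  assumes "variant subst_lit vars_lit c d"
  shows "M_lc_raw c = M_lc_raw d"
proof -
  obtain L \<sigma> \<sigma>' \<pi> where c: "c = (L, \<sigma>)" "d = (L \<cdot>l (\<lambda>x. Var (\<pi> x)), \<sigma>')"
    and \<pi>: "bij \<pi>" "\<forall>x\<in>vars_lit L. \<sigma> x = \<sigma>' (\<pi> x)"
    using assms by (auto simp: variant_def)
  have "tcl s \<sigma> = tcl (s \<cdot> (\<lambda>x. Var (\<pi> x))) \<sigma>'" if "s \<in> set_lit L" for s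
    using that \<pi> unfolding tcl_eq_iff by (intro exI[of _ \<pi>]) (auto simp: vars_lit_def)
  moreover have "s \<cdot> \<sigma> = s \<cdot> (\<lambda>x. Var (\<pi> x)) \<cdot> \<sigma>'" if "s \<in> set_lit L" for s
    using that \<pi>(2) by (auto simp: subst_trm_comp vars_lit_def intro!: subst_trm_cong)
  ultimately show ?thesis
    unfolding c by (cases L rule: lit_exhaust) (simp_all add: subst_lit_def)
qed

lift_definition M_lc :: "('f, 'v) lit_closure \<Rightarrow> ('f, 'v) trm_closure multiset" is M_lc_raw
  by (rule M_lc_raw_variant)

lemma M_lc_simps [simp]:
  "M_lc (lcl (s \<approx> t) \<theta>) = {#tcl s \<theta>, tcl t \<theta>#}"
  "M_lc (lcl (s \<napprox> t) \<theta>) = {#tcl s \<theta>, tcl (s \<cdot> \<theta>) Var, tcl t \<theta>, tcl (t \<cdot> \<theta>) Var#}"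
  by (transfer fixing: s t \<theta>; simp)+

definition lc_gt :: "(('f, 'v) trm_closure \<Rightarrow> ('f, 'v) trm_closure \<Rightarrow> bool) \<Rightarrow>
    ('f, 'v) lit_closure \<Rightarrow> ('f, 'v) lit_closure \<Rightarrow> bool" where
  "lc_gt tc_gt K K' \<longleftrightarrow> multiset_gt tc_gt (M_lc K) (M_lc K')"

definition M_cc :: "('f, 'v) clause \<times> ('f, 'v) subst \<Rightarrow> ('f, 'v) lit_closure multiset" where
  "M_cc = (\<lambda>(C, \<sigma>). if \<exists>L. C = {#L#} then image_mset (\<lambda>L. lcl L \<sigma>) C
                    else image_mset (\<lambda>L. lcl (L \<cdot>l \<sigma>) Var) C)"

definition cc_gt :: "(('f, 'v) trm_closure \<Rightarrow> ('f, 'v) trm_closure \<Rightarrow> bool) \<Rightarrow>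
    ('f, 'v) clause \<times> ('f, 'v) subst \<Rightarrow> ('f, 'v) clause \<times> ('f, 'v) subst \<Rightarrow> bool" where
  "cc_gt tc_gt c d \<longleftrightarrow> multiset_gt (lc_gt tc_gt) (M_cc c) (M_cc d)"

definition ground_closures_of :: "('f \<times> nat) set \<Rightarrow> ('f, 'v) clause set \<Rightarrow>
    (('f, 'v) clause \<times> ('f, 'v) subst) set" where
  "ground_closures_of F S = {(D, \<rho>). D \<in> S \<and> is_subst F \<rho> \<and> vars_cls (D \<cdot>c \<rho>) = {}}"

definition closure_redundant :: "('f \<times> nat) set \<Rightarrow>
    (('f, 'v) trm_closure \<Rightarrow> ('f, 'v) trm_closure \<Rightarrow> bool) \<Rightarrow>
    ('f, 'v) clause \<Rightarrow> ('f, 'v) clause set \<Rightarrow> bool" where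
  "closure_redundant F tc_gt C S \<longleftrightarrow>
     (\<forall>\<theta>. is_subst F \<theta> \<longrightarrow> vars_cls (C \<cdot>c \<theta>) = {} \<longrightarrow>
        (\<exists>G \<subseteq> ground_closures_of F S.
           entails F {D \<cdot>c \<rho> | D \<rho>. (D, \<rho>) \<in> G} (C \<cdot>c \<theta>) \<and>
           (\<forall>d\<in>G. cc_gt tc_gt (C, \<theta>) d)))"

end

theory Submission
  imports Defs
begin

text \<open>A ground instance \<open>C\<sigma>\<close> is entailed by \<open>C'\<sigma>\<close> and the instance \<open>l\<theta>\<sigma> \<approx> r\<theta>\<sigma>\<close> of the rule, the latter
  taken as the closure \<open>\<langle>l \<approx> r, \<theta>\<sigma>\<rangle>\<close>. The first closure is smaller since
  \<open>l\<theta>\<sigma> \<succ> r\<theta>\<sigma>\<close>. For the second, the point is that \<open>\<langle>s\<theta>, \<rho>\<rangle>\<close> is never smaller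
  than \<open>\<langle>s, \<theta>\<rho>\<rangle>\<close>: either \<open>s\<theta> \<sqsupset> s\<close>, or \<open>\<theta>\<close> renames the variables of \<open>s\<close> and the two closures
  coincide.\<close>

section \<open>Terms and contexts\<close>

lemma subst_in_trms:
  assumes "t \<in> trms F" "is_subst F \<sigma>"
  shows "t \<cdot> \<sigma> \<in> trms F"
  using assms by induction (auto simp: is_subst_def intro!: trms.Fun)

lemma is_subst_Var [simp]: "is_subst F Var"
  by (auto simp: is_subst_def intro: trms.Var)

lemma is_subst_comp:
  "is_subst F \<sigma> \<Longrightarrow> is_subst F \<tau> \<Longrightarrow> is_subst F (\<lambda>x. \<sigma> x \<cdot> \<tau>)"
  by (auto simp: is_subst_def intro!: subst_in_trms)

lemma plug_in_trmsD: "plug K s \<in> trms F \<Longrightarrow> s \<in> trms F"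
  by (induction K) (auto elim: trms.cases)

lemma plug_in_trms_replace:
  "plug K s \<in> trms F \<Longrightarrow> t \<in> trms F \<Longrightarrow> plug K t \<in> trms F"
proof (induction K)
  case (More f us K vs)
  from More.prems(1) have "(f, length (us @ plug K s # vs)) \<in> F"
    "\<forall>t\<in>set (us @ plug K s # vs). t \<in> trms F"
    by (auto elim: trms.cases)
  with More show ?case by (auto intro!: trms.Fun)
qed simp

text \<open>The second conclusion keeps proper contexts proper under instantiation, so that
  \<open>gt_subterm\<close> can be applied to instances.\<close>

lemma plug_subst:
  obtains K' where "\<And>s. plug K s \<cdot> \<sigma> = plug K' (s \<cdot> \<sigma>)" "K' = Hole \<longleftrightarrow> K = Hole"
proof -
  have "\<exists>K'. (\<forall>s. plug K s \<cdot> \<sigma> = plug K' (s \<cdot> \<sigma>)) \<and> (K' = Hole \<longleftrightarrow> K = Hole)"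
  proof (induction K)
    case Hole
    then show ?case by (intro exI[of _ Hole]) simp
  next
    case (More f us K vs)
    then obtain K' where "\<forall>s. plug K s \<cdot> \<sigma> = plug K' (s \<cdot> \<sigma>)" by blast
    then show ?case
      by (intro exI[of _ "More f (map (\<lambda>t. t \<cdot> \<sigma>) us) K' (map (\<lambda>t. t \<cdot> \<sigma>) vs)"]) simp
  qed
  then show thesis using that by blast
qed

lemma plug_Var_of_vars: "x \<in> vars_trm t \<Longrightarrow> \<exists>K. t = plug K (Var x)"
proof (induction t)
  case (Var y)
  then show ?case by (intro exI[of _ Hole]) simp
next
  case (Fun f ts)
  then obtain t where t: "t \<in> set ts" "x \<in> vars_trm t" by auto
  with Fun.IH obtain K where "t = plug K (Var x)" by blast
  moreover obtain us vs where "ts = us @ t # vs" using t(1) by (meson split_list)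
  ultimately show ?case by (intro exI[of _ "More f us K vs"]) simp
qed

lemma vars_subset_plug: "vars_trm s \<subseteq> vars_trm (plug K s)"
  by (induction K) auto

lemma vars_plug_mono: "vars_trm s \<subseteq> vars_trm t \<Longrightarrow> vars_trm (plug K s) \<subseteq> vars_trm (plug K t)"
  by (induction K) auto

lemma size_plug: "K \<noteq> Hole \<Longrightarrow> size s < size (plug K s)"
proof (induction K)
  case (More f us K vs)
  then show ?case by (cases "K = Hole") auto
qed simp

lemma finite_vars_trm: "finite (vars_trm t)"
  by (induction t) auto

lemma subst_ground: "vars_trm t = {} \<Longrightarrow> t \<cdot> \<sigma> = t"
  using subst_trm_cong[of t \<sigma> Var] by simp

lemma subst_eq_self: "t \<cdot> \<sigma> = t \<Longrightarrow> x \<in> vars_trm t \<Longrightarrow> \<sigma> x = Var x"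
proof (induction t)
  case (Fun f ts)
  then obtain t where "t \<in> set ts" "x \<in> vars_trm t" by auto
  moreover from this(1) have "t \<cdot> \<sigma> = t"
    using Fun.prems(1) by (simp add: map_idI list_eq_iff_nth_eq in_set_conv_nth) blast
  ultimately show ?case using Fun.IH by blast
qed simp

text \<open>A substitution leading from \<open>t \<cdot> \<theta> \<cdot> \<sigma>\<close> back to
  \<open>t\<close>, composed after \<sigma>, would lead from \<open>t \<cdot> \<theta>\<close> back
  to \<open>t\<close>.\<close>

lemma less_general_subst:
  assumes "t \<cdot> \<theta> \<sqsupset> t"
  shows "t \<cdot> \<theta> \<cdot> \<sigma> \<sqsupset> t"
  using assms unfolding less_general_def subst_trm_comp by blast

section \<open>Renamings\<close>

text \<open>With B the image of A, the finite sets A - B and B - A have the same size. So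
  \<open>p\<close> on A is completed by a bijection from B - A to A - B and by the identity
  elsewhere.\<close>

lemma inj_on_finite_extend_bij:
  fixes p :: "'a \<Rightarrow> 'a"
  assumes "inj_on p A" "finite A"
  obtains \<pi> where "bij \<pi>" "\<And>x. x \<in> A \<Longrightarrow> \<pi> x = p x"
proof -
  let ?B = "p ` A"
  have "card (?B - A) = card (A - ?B)"
    using assms card_image[OF assms(1)] by (simp add: card_Diff_subset_Int Int_commute)
  then obtain g where g: "bij_betw g (?B - A) (A - ?B)"
    using assms(2) finite_same_card_bij by (metis finite_Diff finite_imageI)
  define q where "q x = (if x \<in> ?B then g x else x)" for x
  define \<pi> where "\<pi> x = (if x \<in> A then p x else q x)" for x
  have 1: "bij_betw \<pi> A ?B"
    using inj_on_imp_bij_betw[OF assms(1)] by (subst bij_betw_cong[of _ _ p]) (auto simp: \<pi>_def)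
  have 2: "bij_betw \<pi> (?B - A) (A - ?B)"
    using g by (subst bij_betw_cong[of _ _ g]) (auto simp: \<pi>_def q_def)
  have 3: "bij_betw \<pi> (- (A \<union> ?B)) (- (A \<union> ?B))"
    by (subst bij_betw_cong[of _ _ id]) (auto simp: \<pi>_def q_def)
  have "bij_betw \<pi> (A \<union> (?B - A) \<union> - (A \<union> ?B)) (?B \<union> (A - ?B) \<union> - (A \<union> ?B))"
    by (intro bij_betw_combine 1 2 3) auto
  moreover have "A \<union> (?B - A) \<union> - (A \<union> ?B) = UNIV" "?B \<union> (A - ?B) \<union> - (A \<union> ?B) = UNIV" by auto
  ultimately have "bij \<pi>" by simp
  then show thesis by (rule that) (simp add: \<pi>_def)
qed

text \<open>\<nu> undoes \<theta> on the variables of \<open>s\<close>, so there \<theta> maps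
  injectively to variables. Equality of closures asks for a bijection on all variables, hence the
  extension.\<close>

lemma tcl_renaming:
  assumes "s \<cdot> \<theta> \<cdot> \<nu> = s"
  shows "tcl s (\<lambda>x. \<theta> x \<cdot> \<rho>) = tcl (s \<cdot> \<theta>) \<rho>"
proof -
  have \<nu>: "\<theta> x \<cdot> \<nu> = Var x" if "x \<in> vars_trm s" for x
    using subst_eq_self[of s "\<lambda>x. \<theta> x \<cdot> \<nu>"] assms that by (simp add: subst_trm_comp)
  have "\<exists>y. \<theta> x = Var y" if "x \<in> vars_trm s" for x
    using \<nu>[OF that] by (cases "\<theta> x") auto
  then obtain p where p: "\<And>x. x \<in> vars_trm s \<Longrightarrow> \<theta> x = Var (p x)" by metis
  have "inj_on p (vars_trm s)"
    by (rule inj_onI) (metis \<nu> p trm.inject(1))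
  then obtain \<pi> where "bij \<pi>" and \<pi>: "\<And>x. x \<in> vars_trm s \<Longrightarrow> \<pi> x = p x"
    using inj_on_finite_extend_bij finite_vars_trm by blast
  moreover have "s \<cdot> (\<lambda>x. Var (\<pi> x)) = s \<cdot> \<theta>"
    using \<pi> p by (intro subst_trm_cong) simp
  ultimately show ?thesis
    unfolding tcl_eq_iff using p by (intro exI[of _ \<pi>]) simp
qed

section \<open>Literals and clauses\<close>

lemma subst_lit_simps [simp]:
  "(s \<approx> t) \<cdot>l \<sigma> = (s \<cdot> \<sigma>) \<approx> (t \<cdot> \<sigma>)" "(s \<napprox> t) \<cdot>l \<sigma> = (s \<cdot> \<sigma>) \<napprox> (t \<cdot> \<sigma>)"
  by (simp_all add: subst_lit_def)

lemma set_lit_subst: "set_lit (L \<cdot>l \<sigma>) = (\<lambda>t. t \<cdot> \<sigma>) ` set_lit L"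
  by (simp add: subst_lit_def lit.set_map)

lemma set_mset_M_l [simp]: "set_mset (M_l L) = set_lit L"
  by (cases L rule: lit_exhaust) auto

lemma tcl_in_M_lc: "s \<in> set_lit L \<Longrightarrow> tcl s \<rho> \<in># M_lc (lcl L \<rho>)"
  by (cases L rule: lit_exhaust) auto

lemma vars_subst_cls: "vars_cls (C \<cdot>c \<sigma>) = (\<Union>x\<in>vars_cls C. vars_trm (\<sigma> x))"
  by (auto simp: vars_cls_def subst_cls_def vars_subst_lit)

lemma replace_in_lit_vars:
  assumes "replace_in_lit u v L L'" "vars_trm v \<subseteq> vars_trm u"
  shows "vars_lit L' \<subseteq> vars_lit L"
  using assms(1) vars_plug_mono[OF assms(2)] by cases (auto simp: vars_lit_def)

section \<open>Semantics of substitution and replacement\<close>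

lemma eval_subst: "eval I \<alpha> (t \<cdot> \<sigma>) = eval I (\<lambda>x. eval I \<alpha> (\<sigma> x)) t"
  by (induction t) (simp_all add: comp_def cong: map_cong)

lemma lit_true_subst: "lit_true I \<alpha> (L \<cdot>l \<sigma>) \<longleftrightarrow> lit_true I (\<lambda>x. eval I \<alpha> (\<sigma> x)) L"
  by (cases L rule: lit_exhaust) (simp_all add: eval_subst)

lemma eval_plug_cong: "eval I \<alpha> u = eval I \<alpha> v \<Longrightarrow> eval I \<alpha> (plug K u) = eval I \<alpha> (plug K v)"
  by (induction K) simp_all

lemma replace_in_lit_true:
  assumes "replace_in_lit u v L L'" "eval I \<alpha> u = eval I \<alpha> v"
  shows "lit_true I \<alpha> L \<longleftrightarrow> lit_true I \<alpha> L'"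
  using assms(1) eval_plug_cong[OF assms(2)] by cases simp_all

lemma entails_rewrite:
  fixes F :: "('f \<times> nat) set" and l r :: "('f, 'v) trm"
  assumes "is_subst F \<theta>" and "replace_in_cls (l \<cdot> \<theta>) (r \<cdot> \<theta>) C C'"
  shows "entails F {{#l \<approx> r#}, C} C'"
  unfolding entails_def cls_true_def
proof (intro allI impI)
  fix D :: "('f, 'v) trm set" and I and \<alpha> :: "'v \<Rightarrow> ('f, 'v) trm"
  assume S: "is_structure F D I" and \<alpha>: "range \<alpha> \<subseteq> D"
    and E: "\<forall>E\<in>{{#l \<approx> r#}, C}. \<forall>\<alpha>. range \<alpha> \<subseteq> D \<longrightarrow> (\<exists>L\<in>#E. lit_true I \<alpha> L)"
  obtain L L' B where L: "replace_in_lit (l \<cdot> \<theta>) (r \<cdot> \<theta>) L L'"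
    and C: "C = add_mset L B" "C' = add_mset L' B"
    using assms(2) by cases
  \<comment> \<open>The rule holds under all assignments; it is used at the one giving
    \<open>x\<close> the value of \<open>\<theta> x\<close>.\<close>
  have "range (\<lambda>x. eval I \<alpha> (\<theta> x)) \<subseteq> D"
    using eval_in_structure[OF S \<alpha>] assms(1) by (auto simp: is_subst_def)
  with E have "eval I \<alpha> (l \<cdot> \<theta>) = eval I \<alpha> (r \<cdot> \<theta>)" by (simp add: eval_subst)
  with replace_in_lit_true[OF L] have "lit_true I \<alpha> L \<longleftrightarrow> lit_true I \<alpha> L'" by blast
  then show "\<exists>L\<in>#C'. lit_true I \<alpha> L" using E \<alpha> by (auto simp: C)
qed

text \<open>Evaluating \<sigma>-instances under \<alpha> amounts to evaluating the original
  expressions under \<open>?\<beta>\<close>. There the two sides of the rule agree, so the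
  replacement preserves truth in both directions, and its position need not be traced through
  \<sigma>.\<close>

lemma entails_ground_rewrite:
  fixes F :: "('f \<times> nat) set" and l r :: "('f, 'v) trm"
  assumes "replace_in_cls (l \<cdot> \<theta>) (r \<cdot> \<theta>) C C'"
  shows "entails F {{#l \<cdot> \<theta> \<cdot> \<sigma> \<approx> r \<cdot> \<theta> \<cdot> \<sigma>#}, C' \<cdot>c \<sigma>} (C \<cdot>c \<sigma>)"
  unfolding entails_def cls_true_def
proof (intro allI impI)
  fix D :: "('f, 'v) trm set" and I and \<alpha> :: "'v \<Rightarrow> ('f, 'v) trm"
  assume \<alpha>: "range \<alpha> \<subseteq> D"
    and E: "\<forall>E\<in>{{#l \<cdot> \<theta> \<cdot> \<sigma> \<approx> r \<cdot> \<theta> \<cdot> \<sigma>#}, C' \<cdot>c \<sigma>}.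
      \<forall>\<alpha>. range \<alpha> \<subseteq> D \<longrightarrow> (\<exists>L\<in>#E. lit_true I \<alpha> L)"
  obtain L L' B where L: "replace_in_lit (l \<cdot> \<theta>) (r \<cdot> \<theta>) L L'"
    and C: "C = add_mset L B" "C' = add_mset L' B"
    using assms by cases
  let ?\<beta> = "\<lambda>x. eval I \<alpha> (\<sigma> x)"
  have "eval I ?\<beta> (l \<cdot> \<theta>) = eval I ?\<beta> (r \<cdot> \<theta>)"
    using E \<alpha> by (simp add: eval_subst[symmetric])
  with replace_in_lit_true[OF L] have "lit_true I ?\<beta> L \<longleftrightarrow> lit_true I ?\<beta> L'" by blast
  then show "\<exists>L\<in>#C \<cdot>c \<sigma>. lit_true I \<alpha> L"
    using E \<alpha> by (auto simp: C subst_cls_def lit_true_subst)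
qed

section \<open>Multiset extension\<close>

lemma multiset_gt_irrefl: "\<not> multiset_gt gt A A"
  by (simp add: multiset_gt_iff)

text \<open>Irreflexivity at \<open>y\<close> keeps \<open>y\<close> out of \<open>B\<close>, so
  \<open>y\<close> is a surplus of \<open>A\<close> above every element of \<open>B\<close>. It is a
  premise about \<open>y\<close> alone because \<open>tc_gt\<close> is known to be irreflexive only
  on ground closures.\<close>

lemma multiset_gt_dominate:
  assumes "y \<in># A" "\<not> gt y y" "\<And>x. x \<in># B \<Longrightarrow> gt y x"
  shows "multiset_gt gt A B"
proof -
  have "y \<notin># B" using assms by blast
  then have "count A y > count B y" using assms(1) by (simp add: not_in_iff)
  moreover have "x \<in># B" if "count B x > count A x" for x using that
    by (metis count_greater_zero_iff less_nat_zero_code neq0_conv)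
  ultimately show ?thesis unfolding multiset_gt_iff using assms(3) by (metis nat_neq_iff)
qed

lemma multiset_gt_cancel: "multiset_gt gt (A + M) (B + M) \<longleftrightarrow> multiset_gt gt A B"
  by (simp add: multiset_gt_iff)

lemmas multiset_gt_add = multiset_gt_cancel[THEN iffD2]

lemma lc_gt_irrefl: "\<not> lc_gt tc_gt K K"
  by (simp add: lc_gt_def multiset_gt_irrefl)

lemma M_cc_single: "M_cc ({#L#}, \<sigma>) = {#lcl L \<sigma>#}"
  by (simp add: M_cc_def)

lemma M_cc_not_single:
  "B \<noteq> {#} \<Longrightarrow> M_cc (add_mset L B, \<sigma>) = image_mset (\<lambda>L. lcl (L \<cdot>l \<sigma>) Var) (add_mset L B)"
  by (simp add: M_cc_def)

section \<open>Comparing closures\<close>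

locale closure_orderings =
  fixes F :: "('f \<times> nat) set"
    and gt :: "('f, 'v) trm \<Rightarrow> ('f, 'v) trm \<Rightarrow> bool"
    and tc_gt :: "('f, 'v) trm_closure \<Rightarrow> ('f, 'v) trm_closure \<Rightarrow> bool"
  assumes red: "reduction_ordering F gt" and total: "totalp_on (ground_trms F) gt"
    and clo: "closure_ordering F gt tc_gt"
begin

section \<open>Consequences of the axioms of reduction orderings\<close>

lemma gt_trans:
  "gt s t \<Longrightarrow> gt t u \<Longrightarrow> s \<in> trms F \<Longrightarrow> t \<in> trms F \<Longrightarrow> u \<in> trms F \<Longrightarrow> gt s u"
  using red unfolding reduction_ordering_def by (meson transp_onD)

lemma gt_subst:
  "gt s t \<Longrightarrow> s \<in> trms F \<Longrightarrow> t \<in> trms F \<Longrightarrow> is_subst F \<sigma> \<Longrightarrow> gt (s \<cdot> \<sigma>) (t \<cdot> \<sigma>)"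
  using red unfolding reduction_ordering_def by blast

lemma gt_plug:
  "gt s t \<Longrightarrow> plug K s \<in> trms F \<Longrightarrow> t \<in> trms F \<Longrightarrow> gt (plug K s) (plug K t)"
  using red plug_in_trmsD unfolding reduction_ordering_def by blast

text \<open>If \<open>s\<close> were above \<open>plug K s\<close>, compatibility with contexts
  would put \<open>plug K s\<close> above \<open>plug K (plug K s)\<close>, and so on forever. In
  the induction, \<open>plug K s\<close> is the smaller term with the same defect.\<close>

lemma not_gt_plug:
  assumes "plug K s \<in> trms F"
  shows "\<not> gt s (plug K s)"
proof -
  have wf: "wfp_on (trms F) gt\<inverse>\<inverse>" using red by (simp add: reduction_ordering_def)
  have "s \<in> trms F" using assms plug_in_trmsD by blast
  from wf show ?thesis using assms
  proof (induction s rule: wfp_on_induct)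
    case in_set
    show ?case using \<open>s \<in> trms F\<close> .
  next
    case (less s)
    then show ?case
      using plug_in_trms_replace gt_plug by blast
  qed
qed

lemma gt_irrefl: "s \<in> trms F \<Longrightarrow> \<not> gt s s"
  using not_gt_plug[of Hole] by simp

text \<open>If \<open>x\<close> occurs in \<open>t\<close> but not in \<open>s\<close>, substituting
  \<open>s\<close> for \<open>x\<close> fixes \<open>s\<close> and turns \<open>t\<close> into a
  term containing \<open>s\<close>, against \<open>not_gt_plug\<close>.\<close>

lemma gt_vars:
  assumes "gt s t" "s \<in> trms F" "t \<in> trms F"
  shows "vars_trm t \<subseteq> vars_trm s"
proof (rule ccontr)
  assume "\<not> vars_trm t \<subseteq> vars_trm s"
  then obtain x where x: "x \<in> vars_trm t" "x \<notin> vars_trm s" by blast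
  let ?\<sigma> = "Var(x := s)"
  have \<sigma>: "is_subst F ?\<sigma>" using assms(2) by (auto simp: is_subst_def intro: trms.Var)
  have s: "s \<cdot> ?\<sigma> = s" using subst_trm_cong[of s ?\<sigma> Var] x(2) by (metis fun_upd_apply subst_trm_Var)
  obtain K where "t = plug K (Var x)" using plug_Var_of_vars[OF x(1)] by blast
  then obtain K' where "t \<cdot> ?\<sigma> = plug K' s" using plug_subst[of K ?\<sigma>] by (metis fun_upd_same subst_trm.simps(1))
  then show False
    using gt_subst[OF assms \<sigma>] not_gt_plug subst_in_trms[OF assms(3) \<sigma>] s by metis
qed

text \<open>Ground totality leaves only the reverse comparison, which \<open>not_gt_plug\<close>
  excludes.\<close>

lemma gt_subterm:
  assumes "plug K s \<in> ground_trms F" "K \<noteq> Hole"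
  shows "gt (plug K s) s"
proof -
  have "s \<in> ground_trms F"
    using assms(1) plug_in_trmsD vars_subset_plug[of s K] by (auto simp: ground_trms_def)
  moreover have "plug K s \<noteq> s" using size_plug[OF assms(2), of s] by force
  ultimately show ?thesis
    using total assms(1) not_gt_plug unfolding totalp_on_def ground_trms_def by blast
qed

section \<open>Comparison of ground term closures\<close>

lemma tc_gt_if_gt:
  assumes "s \<in> trms F" "t \<in> trms F" "is_subst F \<sigma>" "is_subst F \<rho>"
    "s \<cdot> \<sigma> \<in> ground_trms F" "t \<cdot> \<rho> \<in> ground_trms F" "gt (s \<cdot> \<sigma>) (t \<cdot> \<rho>)"
  shows "tc_gt (tcl s \<sigma>) (tcl t \<rho>)"
  using clo assms unfolding closure_ordering_def by blast

lemma tc_gt_if_less_general: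
  assumes "s \<in> trms F" "t \<in> trms F" "is_subst F \<sigma>" "is_subst F \<rho>"
    "s \<cdot> \<sigma> \<in> ground_trms F" "s \<cdot> \<sigma> = t \<cdot> \<rho>" "s \<sqsupset> t"
  shows "tc_gt (tcl s \<sigma>) (tcl t \<rho>)"
  using clo assms unfolding closure_ordering_def by metis

lemma tc_gt_irrefl:
  assumes "s \<in> trms F" "is_subst F \<sigma>" "s \<cdot> \<sigma> \<in> ground_trms F"
  shows "\<not> tc_gt (tcl s \<sigma>) (tcl s \<sigma>)"
proof -
  have "wfp_on (ground_trm_closures F) tc_gt\<inverse>\<inverse>" using clo by (simp add: closure_ordering_def)
  moreover have "tcl s \<sigma> \<in> ground_trm_closures F"
    using assms by (auto simp: ground_trm_closures_def)
  ultimately show ?thesis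
    using wfp_on_induct[of _ _ "tcl s \<sigma>" "\<lambda>c. \<not> tc_gt c c"] by blast
qed

lemma tc_ge_subst:
  assumes "s \<in> trms F" "is_subst F \<theta>" "is_subst F \<rho>" "s \<cdot> \<theta> \<cdot> \<rho> \<in> ground_trms F"
  shows "tcl (s \<cdot> \<theta>) \<rho> = tcl s (\<lambda>x. \<theta> x \<cdot> \<rho>) \<or> tc_gt (tcl (s \<cdot> \<theta>) \<rho>) (tcl s (\<lambda>x. \<theta> x \<cdot> \<rho>))"
proof (cases "s \<cdot> \<theta> \<sqsupset> s")
  case True
  then show ?thesis
    using assms by (intro disjI2 tc_gt_if_less_general)
      (auto simp: subst_trm_comp intro: subst_in_trms is_subst_comp)
next
  case False
  \<comment> \<open>Since \<open>s \<cdot> \<theta>\<close> is an instance of \<open>s\<close>, the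
    failure of \<sqsupset> can only mean that it also matches back to \<open>s\<close>.\<close>
  then obtain \<nu> where "s \<cdot> \<theta> \<cdot> \<nu> = s" by (auto simp: less_general_def)
  then show ?thesis using tcl_renaming by metis
qed

text \<open>Unit clauses contribute the closures \<open>\<langle>L, \<sigma>\<rangle>\<close> and other clauses \<open>\<langle>L\<sigma>, id\<rangle>\<close>. Both have the
  form \<open>\<langle>L\<tau>, \<rho>\<rangle>\<close> with \<open>\<tau>\<rho> = \<sigma>\<close>, which is how literals are compared below.\<close>

lemma lc_gt_replace:
  assumes "replace_in_lit u v L L'" "gt u v" "v \<in> trms F" "set_lit L \<subseteq> trms F"
    "is_subst F \<tau>" "is_subst F \<rho>" "vars_lit (L \<cdot>l \<tau> \<cdot>l \<rho>) = {}"
  shows "lc_gt tc_gt (lcl (L \<cdot>l \<tau>) \<rho>) (lcl (L' \<cdot>l \<tau>) \<rho>)"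
proof -
  let ?\<sigma> = "\<lambda>x. \<tau> x \<cdot> \<rho>"
  have \<sigma>: "is_subst F ?\<sigma>" using assms by (auto intro: is_subst_comp)
  have key: "plug K u \<cdot> \<tau> \<in> trms F" "plug K u \<cdot> \<tau> \<cdot> \<rho> \<in> ground_trms F"
    "tc_gt (tcl (plug K u \<cdot> \<tau>) \<rho>) (tcl (plug K v \<cdot> \<tau>) \<rho>)"
    "tc_gt (tcl (plug K u \<cdot> \<tau>) \<rho>) (tcl (plug K v \<cdot> \<tau> \<cdot> \<rho>) Var)"
    if "plug K u \<in> set_lit L" for K
  proof -
    have u: "plug K u \<in> trms F" "vars_trm (plug K u \<cdot> ?\<sigma>) = {}"
      using that assms(4,7) by (auto simp: vars_lit_def set_lit_subst subst_trm_comp)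
    have v: "plug K v \<in> trms F" using plug_in_trms_replace u(1) assms(3) by blast
    have g: "gt (plug K u \<cdot> ?\<sigma>) (plug K v \<cdot> ?\<sigma>)"
      using assms u v \<sigma> by (intro gt_subst gt_plug) auto
    \<comment> \<open>Closures are compared only when ground; \<open>gt_vars\<close> passes
      groundness from the larger term to the smaller one.\<close>
    have "vars_trm (plug K v \<cdot> ?\<sigma>) = {}"
      using gt_vars[OF g] u v \<sigma> by (auto intro: subst_in_trms)
    then have gr: "plug K u \<cdot> ?\<sigma> \<in> ground_trms F" "plug K v \<cdot> ?\<sigma> \<in> ground_trms F"
      using u v \<sigma> by (auto simp: ground_trms_def intro: subst_in_trms)
    show trm: "plug K u \<cdot> \<tau> \<in> trms F" and "plug K u \<cdot> \<tau> \<cdot> \<rho> \<in> ground_trms F"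
      using u assms(5) gr by (auto intro: subst_in_trms simp: subst_trm_comp)
    show "tc_gt (tcl (plug K u \<cdot> \<tau>) \<rho>) (tcl (plug K v \<cdot> \<tau>) \<rho>)"
      "tc_gt (tcl (plug K u \<cdot> \<tau>) \<rho>) (tcl (plug K v \<cdot> \<tau> \<cdot> \<rho>) Var)"
      using trm v assms(5,6) \<sigma> gr g
      by (intro tc_gt_if_gt; simp add: subst_trm_comp subst_in_trms)+
  qed
  from assms(1) show ?thesis
  proof cases
    case (1 K t)
    \<comment> \<open>The untouched side \<open>t\<close> contributes the same closure to both
      literals, so it is added back by cancellation.\<close>
    have "multiset_gt tc_gt {#tcl (plug K u \<cdot> \<tau>) \<rho>#} {#tcl (plug K v \<cdot> \<tau>) \<rho>#}"
      using key[of K] assms(6) 1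
      by (intro multiset_gt_dominate[of "tcl (plug K u \<cdot> \<tau>) \<rho>"] tc_gt_irrefl) auto
    from multiset_gt_add[OF this, of "{#tcl (t \<cdot> \<tau>) \<rho>#}"] show ?thesis
      by (simp add: 1 lc_gt_def add_mset_commute)
  next
    case (2 K t)
    \<comment> \<open>A single closure of the old side beats both closures of the new side, since
      both represent a smaller term.\<close>
    have "multiset_gt tc_gt {#tcl (plug K u \<cdot> \<tau>) \<rho>, tcl (plug K u \<cdot> \<tau> \<cdot> \<rho>) Var#}
      {#tcl (plug K v \<cdot> \<tau>) \<rho>, tcl (plug K v \<cdot> \<tau> \<cdot> \<rho>) Var#}"
      using key[of K] assms(6) 2
      by (intro multiset_gt_dominate[of "tcl (plug K u \<cdot> \<tau>) \<rho>"] tc_gt_irrefl) auto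
    from multiset_gt_add[OF this, of "{#tcl (t \<cdot> \<tau>) \<rho>, tcl (t \<cdot> \<tau> \<cdot> \<rho>) Var#}"] show ?thesis
      by (simp add: 2 lc_gt_def add_mset_commute)
  qed
qed

text \<open>Replacement preserves the number of literals, so \<open>C\<close> and \<open>C'\<close>
  are both unit or both non-unit and contribute closures of the same form.\<close>

lemma cc_gt_replace:
  assumes "replace_in_cls u v C C'" "gt u v" "v \<in> trms F" "C \<in> clauses F"
    "is_subst F \<sigma>" "vars_cls (C \<cdot>c \<sigma>) = {}"
  shows "cc_gt tc_gt (C, \<sigma>) (C', \<sigma>)"
proof -
  obtain L L' B where L: "replace_in_lit u v L L'"
    and C: "C = add_mset L B" "C' = add_mset L' B"
    using assms(1) by cases
  have "set_lit L \<subseteq> trms F" using assms(4) by (auto simp: clauses_def C)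
  moreover have "vars_lit (L \<cdot>l \<sigma>) = {}"
    using assms(6) by (auto simp: vars_cls_def subst_cls_def C)
  ultimately have
    1: "lc_gt tc_gt (lcl L \<sigma>) (lcl L' \<sigma>)" and
    2: "lc_gt tc_gt (lcl (L \<cdot>l \<sigma>) Var) (lcl (L' \<cdot>l \<sigma>) Var)"
    using lc_gt_replace[OF L assms(2,3), of Var \<sigma>] lc_gt_replace[OF L assms(2,3), of \<sigma> Var] assms(5)
    by simp_all
  show ?thesis
  proof (cases "B = {#}")
    case True
    have "multiset_gt (lc_gt tc_gt) {#lcl L \<sigma>#} {#lcl L' \<sigma>#}"
      using 1 by (intro multiset_gt_dominate) (auto simp: lc_gt_irrefl)
    then show ?thesis by (simp add: True C cc_gt_def M_cc_single)
  next
    case False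
    have "multiset_gt (lc_gt tc_gt) {#lcl (L \<cdot>l \<sigma>) Var#} {#lcl (L' \<cdot>l \<sigma>) Var#}"
      using 2 by (intro multiset_gt_dominate) (auto simp: lc_gt_irrefl)
    from multiset_gt_add[OF this] show ?thesis by (simp add: False C cc_gt_def M_cc_not_single)
  qed
qed

section \<open>The closure of the rule against literal closures of the rewritten clause\<close>

context
  fixes l r :: "('f, 'v) trm" and \<theta> :: "('f, 'v) subst"
  assumes l: "l \<in> trms F" and r: "r \<in> trms F" and \<theta>: "is_subst F \<theta>"
    and l_gt_r: "gt (l \<cdot> \<theta>) (r \<cdot> \<theta>)"
begin

text \<open>Taking \<tau> as \<open>Var\<close> yields the form used for unit clauses, taking \<rho>
  as \<open>Var\<close> the form used for all others; \<eta> is the instantiation of the rule in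
  both cases. Groundness of the instance of \<open>l \<cdot> \<theta>\<close> is assumed separately,
  since the literal \<open>M\<close> need not contain that term.\<close>

context
  fixes \<tau> \<rho> \<eta> :: "('f, 'v) subst" and M :: "('f, 'v) trm lit"
  assumes \<tau>: "is_subst F \<tau>" and \<rho>: "is_subst F \<rho>" and M: "set_lit M \<subseteq> trms F"
    and ground_l: "vars_trm (l \<cdot> \<theta> \<cdot> \<tau> \<cdot> \<rho>) = {}" and ground_M: "vars_lit (M \<cdot>l \<tau> \<cdot>l \<rho>) = {}"
  defines "\<eta> \<equiv> \<lambda>x. \<theta> x \<cdot> \<tau> \<cdot> \<rho>"
begin

lemma is_subst_\<eta>: "is_subst F \<eta>"
  unfolding \<eta>_def using \<theta> \<tau> \<rho> by (intro is_subst_comp)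

lemma subst_\<eta>: "t \<cdot> \<eta> = t \<cdot> \<theta> \<cdot> \<tau> \<cdot> \<rho>"
  by (simp add: \<eta>_def subst_trm_comp)

lemma l_\<eta>_gt_r_\<eta>: "gt (l \<cdot> \<eta>) (r \<cdot> \<eta>)"
  unfolding subst_\<eta> using l r \<theta> \<tau> \<rho> l_gt_r by (simp add: gt_subst subst_in_trms)

lemma ground_l_\<eta>: "l \<cdot> \<eta> \<in> ground_trms F"
  using ground_l l is_subst_\<eta> by (auto simp: ground_trms_def subst_\<eta>[symmetric] intro: subst_in_trms)

lemma ground_r_\<eta>: "r \<cdot> \<eta> \<in> ground_trms F"
  using ground_l_\<eta> gt_vars[OF l_\<eta>_gt_r_\<eta>] r l is_subst_\<eta>
  by (auto simp: ground_trms_def intro: subst_in_trms)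

lemma ground_in_M: "s \<in> set_lit M \<Longrightarrow> s \<cdot> \<tau> \<cdot> \<rho> \<in> ground_trms F"
  using ground_M M \<tau> \<rho>
  by (auto simp: ground_trms_def vars_lit_def set_lit_subst intro!: subst_in_trms)

lemma tc_l_gt_tc_r: "tc_gt (tcl (l \<cdot> \<theta> \<cdot> \<tau>) \<rho>) (tcl r \<eta>)"
  using l r \<theta> \<tau> \<rho> ground_l_\<eta> ground_r_\<eta> l_\<eta>_gt_r_\<eta> is_subst_\<eta>
  by (intro tc_gt_if_gt) (auto simp: subst_\<eta> intro: subst_in_trms)

lemma tc_l_ge: "tcl (l \<cdot> \<theta> \<cdot> \<tau>) \<rho> = tcl l \<eta> \<or> tc_gt (tcl (l \<cdot> \<theta> \<cdot> \<tau>) \<rho>) (tcl l \<eta>)"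
  using tc_ge_subst[of l "\<lambda>x. \<theta> x \<cdot> \<tau>" \<rho>] l \<theta> \<tau> \<rho> ground_l_\<eta> is_subst_comp[OF \<theta> \<tau>]
  by (simp add: \<eta>_def subst_trm_comp)

lemma lc_gt_dominate:
  assumes "s \<in> set_lit M" "tc_gt (tcl (s \<cdot> \<tau>) \<rho>) (tcl l \<eta>)" "tc_gt (tcl (s \<cdot> \<tau>) \<rho>) (tcl r \<eta>)"
  shows "lc_gt tc_gt (lcl (M \<cdot>l \<tau>) \<rho>) (lcl (l \<approx> r) \<eta>)"
  unfolding lc_gt_def
proof (rule multiset_gt_dominate)
  show "tcl (s \<cdot> \<tau>) \<rho> \<in># M_lc (lcl (M \<cdot>l \<tau>) \<rho>)"
    using assms(1) by (intro tcl_in_M_lc) (simp add: set_lit_subst)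
  show "\<not> tc_gt (tcl (s \<cdot> \<tau>) \<rho>) (tcl (s \<cdot> \<tau>) \<rho>)"
    using assms(1) M \<tau> \<rho> ground_in_M by (intro tc_gt_irrefl) (auto intro: subst_in_trms)
qed (use assms in auto)

lemma lc_gt_dominate_gt:
  assumes "s \<in> set_lit M" "gt (s \<cdot> \<tau> \<cdot> \<rho>) (l \<cdot> \<eta>)"
  shows "lc_gt tc_gt (lcl (M \<cdot>l \<tau>) \<rho>) (lcl (l \<approx> r) \<eta>)"
proof (rule lc_gt_dominate[OF assms(1)])
  note gr = ground_in_M[OF assms(1)] ground_l_\<eta> ground_r_\<eta>
  have s: "s \<cdot> \<tau> \<in> trms F" using assms(1) M \<tau> by (auto intro: subst_in_trms)
  show "tc_gt (tcl (s \<cdot> \<tau>) \<rho>) (tcl l \<eta>)"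
    using s l \<rho> is_subst_\<eta> gr assms by (intro tc_gt_if_gt)
  have "gt (s \<cdot> \<tau> \<cdot> \<rho>) (r \<cdot> \<eta>)"
    using gt_trans[OF assms(2) l_\<eta>_gt_r_\<eta>] gr by (auto simp: ground_trms_def)
  then show "tc_gt (tcl (s \<cdot> \<tau>) \<rho>) (tcl r \<eta>)"
    using s r \<rho> is_subst_\<eta> gr by (intro tc_gt_if_gt)
qed

text \<open>If \<open>l \<cdot> \<theta>\<close> is a whole side of \<open>M\<close>, the
  represented terms are equal and \<sqsupset> breaks the tie. If it lies deeper, the side of
  \<open>M\<close> is already larger by the subterm property.\<close>

lemma lc_gt_rule_less_general:
  assumes "plug K (l \<cdot> \<theta>) \<in> set_lit M" "l \<cdot> \<theta> \<sqsupset> l"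
  shows "lc_gt tc_gt (lcl (M \<cdot>l \<tau>) \<rho>) (lcl (l \<approx> r) \<eta>)"
proof (cases "K = Hole")
  case True
  have "tc_gt (tcl (l \<cdot> \<theta> \<cdot> \<tau>) \<rho>) (tcl l \<eta>)"
    using l \<theta> \<tau> \<rho> is_subst_\<eta> ground_l_\<eta> less_general_subst[OF assms(2)]
    by (intro tc_gt_if_less_general) (auto simp: subst_\<eta> intro: subst_in_trms)
  then show ?thesis
    using assms True tc_l_gt_tc_r by (intro lc_gt_dominate[of "l \<cdot> \<theta>"]) auto
next
  case False
  have "gt (plug K (l \<cdot> \<theta>) \<cdot> \<tau> \<cdot> \<rho>) (l \<cdot> \<eta>)"
  proof -
    obtain K' where K': "\<And>s. plug K s \<cdot> \<tau> = plug K' (s \<cdot> \<tau>)" "K' \<noteq> Hole"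
      using plug_subst False by metis
    obtain K'' where K'': "\<And>s. plug K' s \<cdot> \<rho> = plug K'' (s \<cdot> \<rho>)" "K'' \<noteq> Hole"
      using plug_subst K'(2) by metis
    show ?thesis
      using gt_subterm[of K'' "l \<cdot> \<eta>"] ground_in_M[OF assms(1)] by (simp add: K' K'' subst_\<eta>)
  qed
  then show ?thesis using assms by (intro lc_gt_dominate_gt)
qed

text \<open>This serves the ties: when the closure of \<open>l\<close> itself occurs in the multiset
  of \<open>K\<close>, it cancels, and the remainder only has to beat the closure of
  \<open>r\<close>.\<close>

lemma lc_gt_cancel:
  assumes "M_lc K = add_mset (tcl l \<eta>) X" "tcl s \<sigma> \<in># X"
    and "s \<in> trms F" "is_subst F \<sigma>" "s \<cdot> \<sigma> \<in> ground_trms F" "gt (s \<cdot> \<sigma>) (r \<cdot> \<eta>)"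
  shows "lc_gt tc_gt K (lcl (l \<approx> r) \<eta>)"
proof -
  have "tc_gt (tcl s \<sigma>) (tcl r \<eta>)"
    using assms(3-6) r is_subst_\<eta> ground_r_\<eta> by (intro tc_gt_if_gt)
  then have "multiset_gt tc_gt X {#tcl r \<eta>#}"
    using assms by (intro multiset_gt_dominate[of "tcl s \<sigma>"] tc_gt_irrefl) auto
  from multiset_gt_add[OF this, of "{#tcl l \<eta>#}"] show ?thesis
    using assms(1) by (simp add: lc_gt_def add_mset_commute)
qed

text \<open>A negative literal contributes two closures representing
  \<open>l \<cdot> \<eta>\<close>, neither below the closure of \<open>l\<close>. If one is strictly
  larger, it dominates the rule; if both tie, one cancels and the other beats the closure of
  \<open>r\<close>.\<close>

lemma lc_gt_rule_neg:
  assumes "M = (l \<cdot> \<theta>) \<napprox> t"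
  shows "lc_gt tc_gt (lcl (M \<cdot>l \<tau>) \<rho>) (lcl (l \<approx> r) \<eta>)"
proof -
  let ?s = "l \<cdot> \<theta> \<cdot> \<tau>"
  have s: "?s \<in> trms F" "?s \<cdot> \<rho> \<in> trms F" "?s \<cdot> \<rho> = l \<cdot> \<eta>"
    using l \<theta> \<tau> \<rho> by (auto simp: subst_\<eta> intro: subst_in_trms)
  consider "tc_gt (tcl ?s \<rho>) (tcl l \<eta>)"
    | "tcl ?s \<rho> = tcl l \<eta>" "tc_gt (tcl (?s \<cdot> \<rho>) Var) (tcl l \<eta>)"
    | "tcl ?s \<rho> = tcl l \<eta>" "tcl (?s \<cdot> \<rho>) Var = tcl l \<eta>"
    using tc_l_ge tc_ge_subst[of ?s \<rho> Var] s \<rho> ground_l_\<eta> by auto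
  then show ?thesis
  proof cases
    case 1
    then show ?thesis
      using assms tc_l_gt_tc_r by (intro lc_gt_dominate[of "l \<cdot> \<theta>"]) auto
  next
    case 2
    have "tc_gt (tcl (?s \<cdot> \<rho>) Var) (tcl r \<eta>)"
      using s r is_subst_\<eta> ground_l_\<eta> ground_r_\<eta> l_\<eta>_gt_r_\<eta> by (intro tc_gt_if_gt) auto
    then show ?thesis
      unfolding lc_gt_def using assms 2 s ground_l_\<eta>
      by (intro multiset_gt_dominate[of "tcl (?s \<cdot> \<rho>) Var"] tc_gt_irrefl) auto
  next
    case 3
    then show ?thesis
      using assms s ground_l_\<eta> l_\<eta>_gt_r_\<eta>
      by (intro lc_gt_cancel[where s = "?s \<cdot> \<rho>" and \<sigma> = Var]) auto
  qed
qed

lemma lc_gt_rule_pos: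
  assumes "M = (l \<cdot> \<theta>) \<approx> t" "gt t (r \<cdot> \<theta>)"
  shows "lc_gt tc_gt (lcl (M \<cdot>l \<tau>) \<rho>) (lcl (l \<approx> r) \<eta>)"
  using tc_l_ge
proof
  assume "tcl (l \<cdot> \<theta> \<cdot> \<tau>) \<rho> = tcl l \<eta>"
  moreover have "gt (t \<cdot> \<tau> \<cdot> \<rho>) (r \<cdot> \<eta>)"
    unfolding subst_\<eta> using assms M r \<theta> \<tau> \<rho> by (simp add: gt_subst subst_in_trms)
  ultimately show ?thesis
    using assms M \<tau> \<rho> ground_in_M[of t]
    by (intro lc_gt_cancel[where s = "t \<cdot> \<tau>" and \<sigma> = \<rho>]) (auto intro: subst_in_trms)
next
  assume "tc_gt (tcl (l \<cdot> \<theta> \<cdot> \<tau>) \<rho>) (tcl l \<eta>)"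
  then show ?thesis
    using assms tc_l_gt_tc_r by (intro lc_gt_dominate[of "l \<cdot> \<theta>"]) auto
qed

lemma lc_gt_rule_lit_gt:
  assumes "lit_gt gt M (l \<cdot> \<theta> \<approx> r \<cdot> \<theta>)"
  shows "lc_gt tc_gt (lcl (M \<cdot>l \<tau>) \<rho>) (lcl (l \<approx> r) \<eta>)"
proof (cases "l \<cdot> \<theta> \<in> set_lit M")
  case False
  have "multiset_gt gt (M_l M) {#l \<cdot> \<theta>, r \<cdot> \<theta>#}" using assms by (simp add: lit_gt_def)
  \<comment> \<open>As \<open>l \<cdot> \<theta>\<close> is missing from \<open>M\<close>, the
    multiset comparison must supply a term of \<open>M\<close> above it.\<close>
  moreover have "count (M_l M) (l \<cdot> \<theta>) = 0"
    using False by (metis set_mset_M_l not_in_iff)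
  ultimately obtain s where s: "gt s (l \<cdot> \<theta>)" "count (M_l M) s > 0"
    unfolding multiset_gt_iff
    by (metis count_add_mset less_nat_zero_code neq0_conv zero_less_Suc)
  then have "s \<in> set_lit M" by (metis set_mset_M_l count_greater_zero_iff)
  moreover have "gt (s \<cdot> \<tau> \<cdot> \<rho>) (l \<cdot> \<eta>)"
    unfolding subst_\<eta> using \<open>s \<in> set_lit M\<close> s(1) M l \<theta> \<tau> \<rho>
    by (simp add: gt_subst subst_in_trms subset_iff)
  ultimately show ?thesis by (rule lc_gt_dominate_gt)
next
  case True
  then consider t where "M = l \<cdot> \<theta> \<napprox> t" | t where "M = l \<cdot> \<theta> \<approx> t"
    by (cases M rule: lit_exhaust) (auto simp: insert_commute)
  then show ?thesis
  proof cases
    case (2 t)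
    have ne: "l \<cdot> \<theta> \<noteq> r \<cdot> \<theta>" using l_gt_r gt_irrefl l \<theta> subst_in_trms by metis
    \<comment> \<open>Both positive literals contain \<open>l \<cdot> \<theta>\<close>; cancelling
      it reduces the comparison to the other sides.\<close>
    have "multiset_gt gt ({#t#} + {#l \<cdot> \<theta>#}) ({#r \<cdot> \<theta>#} + {#l \<cdot> \<theta>#})"
      using assms by (simp add: lit_gt_def 2 add_mset_commute)
    then have "multiset_gt gt {#t#} {#r \<cdot> \<theta>#}" by (rule multiset_gt_cancel[THEN iffD1])
    then have "gt t (r \<cdot> \<theta>)"
      unfolding multiset_gt_iff by (auto split: if_splits)
    then show ?thesis using 2 by (intro lc_gt_rule_pos)
  qed (rule lc_gt_rule_neg)
qed

text \<open>This treats the rule instance occurring as a literal of a non-unit clause. Each side in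
  identity form is at least its counterpart in the rule, so the literals are strictly ordered unless
  both sides tie.\<close>

lemma lc_ge_rule_instance:
  assumes "M = l \<cdot> \<theta> \<approx> r \<cdot> \<theta>" "\<rho> = Var"
  shows "lcl (M \<cdot>l \<tau>) Var = lcl (l \<approx> r) \<eta> \<or> lc_gt tc_gt (lcl (M \<cdot>l \<tau>) Var) (lcl (l \<approx> r) \<eta>)"
proof -
  have g: "vars_trm (l \<cdot> \<eta>) = {}" "vars_trm (r \<cdot> \<eta>) = {}"
    using ground_l_\<eta> ground_r_\<eta> by (auto simp: ground_trms_def)
  \<comment> \<open>A renaming leaves the ground term \<open>s \<cdot> \<eta>\<close> unchanged, so
    equal closures force equal terms.\<close>
  have eq: "s \<cdot> \<eta> = s" if "tcl (s \<cdot> \<eta>) Var = tcl s \<eta>" "vars_trm (s \<cdot> \<eta>) = {}" for s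
    using that subst_ground by (metis tcl_eq_iff)
  have ge: "tcl (s \<cdot> \<eta>) Var = tcl s \<eta> \<or> tc_gt (tcl (s \<cdot> \<eta>) Var) (tcl s \<eta>)"
    if "s \<in> {l, r}" for s
    using tc_ge_subst[of s \<eta> Var] that l r is_subst_\<eta> ground_l_\<eta> ground_r_\<eta> by auto
  have M\<tau>: "M \<cdot>l \<tau> = l \<cdot> \<eta> \<approx> r \<cdot> \<eta>" using assms by (simp add: subst_\<eta>)
  consider "tcl (l \<cdot> \<eta>) Var = tcl l \<eta>" "tcl (r \<cdot> \<eta>) Var = tcl r \<eta>"
    | "tcl (l \<cdot> \<eta>) Var = tcl l \<eta>" "tc_gt (tcl (r \<cdot> \<eta>) Var) (tcl r \<eta>)"
    | "tc_gt (tcl (l \<cdot> \<eta>) Var) (tcl l \<eta>)"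
    using ge by auto
  then show ?thesis
  proof cases
    case 1
    \<comment> \<open>Equal closures on the two sides could come from different renamings. Here both
      sides are ground, so the identity serves for the whole literal.\<close>
    then have "l \<cdot> \<eta> = l" "r \<cdot> \<eta> = r" using eq g by auto
    then have "lcl (M \<cdot>l \<tau>) Var = lcl (l \<approx> r) \<eta>"
      using g unfolding M\<tau> lcl_eq_iff
      by (intro exI[of _ id]) (auto simp: vars_lit_def subst_trm_comp)
    then show ?thesis ..
  next
    case 2
    have "\<not> tc_gt (tcl (r \<cdot> \<eta>) Var) (tcl (r \<cdot> \<eta>) Var)"
      using ground_r_\<eta> by (intro tc_gt_irrefl) (auto simp: ground_trms_def)
    then have "multiset_gt tc_gt {#tcl (r \<cdot> \<eta>) Var#} {#tcl r \<eta>#}"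
      using 2 by (intro multiset_gt_dominate) auto
    from multiset_gt_add[OF this, of "{#tcl l \<eta>#}"] show ?thesis
      using 2 by (simp add: M\<tau> lc_gt_def add_mset_commute)
  next
    case 3
    then show ?thesis
      using lc_gt_dominate[of "l \<cdot> \<theta>"] tc_l_gt_tc_r assms by (auto simp: subst_\<eta>)
  qed
qed

end

section \<open>Clause closures and redundancy\<close>

lemma cc_gt_rule:
  assumes C: "C \<in> clauses F" and \<sigma>: "is_subst F \<sigma>" and ground: "vars_cls (C \<cdot>c \<sigma>) = {}"
    and rep: "replace_in_cls (l \<cdot> \<theta>) (r \<cdot> \<theta>) C C'"
    and large: "cls_gt gt C {#l \<cdot> \<theta> \<approx> r \<cdot> \<theta>#} \<or> l \<cdot> \<theta> \<sqsupset> l"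
  shows "cc_gt tc_gt (C, \<sigma>) ({#l \<approx> r#}, \<lambda>x. \<theta> x \<cdot> \<sigma>)"
proof -
  let ?P = "lcl (l \<approx> r) (\<lambda>x. \<theta> x \<cdot> \<sigma>)"
  have lit: "set_lit M \<subseteq> trms F" "vars_lit (M \<cdot>l \<sigma>) = {}" if "M \<in># C" for M
    using that C ground by (auto simp: clauses_def vars_cls_def subst_cls_def)
  obtain M0 K where M0: "M0 \<in># C" "plug K (l \<cdot> \<theta>) \<in> set_lit M0"
    using rep
  proof cases
    case (1 L L' D)
    from 1(3) show thesis
      by cases (auto intro!: that simp: 1)
  qed
  have "vars_trm (l \<cdot> \<theta> \<cdot> \<sigma>) \<subseteq> vars_lit (M0 \<cdot>l \<sigma>)"
    using M0(2) vars_subset_plug[of "l \<cdot> \<theta>" K]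
    by (auto simp: vars_lit_def set_lit_subst vars_subst_trm)
  then have gl: "vars_trm (l \<cdot> \<theta> \<cdot> \<sigma>) = {}" using lit(2)[OF M0(1)] by auto
  \<comment> \<open>The closure of the unit rule contributes only \<open>?P\<close>, so one larger
    literal of \<open>C\<close> suffices. Both forms are required because \<open>C\<close> may or
    may not be a unit clause.\<close>
  have dominated: ?thesis
    if M: "M \<in># C" "lc_gt tc_gt (lcl M \<sigma>) ?P" "lc_gt tc_gt (lcl (M \<cdot>l \<sigma>) Var) ?P" for M
  proof -
    from M(1) obtain B where B: "C = add_mset M B" by (metis mset_add)
    show ?thesis
    proof (cases "B = {#}")
      case True
      then show ?thesis
        unfolding cc_gt_def B using M(2)
        by (intro multiset_gt_dominate[of "lcl M \<sigma>"]) (auto simp: M_cc_single lc_gt_irrefl)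
    next
      case False
      then show ?thesis
        unfolding cc_gt_def B using M(3)
        by (intro multiset_gt_dominate[of "lcl (M \<cdot>l \<sigma>) Var"])
          (auto simp: M_cc_single M_cc_not_single lc_gt_irrefl)
    qed
  qed
  from large show ?thesis
  proof
    assume "l \<cdot> \<theta> \<sqsupset> l"
    then show ?thesis
      using lc_gt_rule_less_general[of Var \<sigma> M0 K] lc_gt_rule_less_general[of \<sigma> Var M0 K]
        lit[OF M0(1)] M0 gl \<sigma>
      by (intro dominated[of M0]) auto
  next
    assume gtC: "cls_gt gt C {#l \<cdot> \<theta> \<approx> r \<cdot> \<theta>#}"
    let ?E = "l \<cdot> \<theta> \<approx> r \<cdot> \<theta>"
    show ?thesis
    proof (cases "?E \<in># C")
      case False
      then have "count {#?E#} ?E > count C ?E" by (simp add: not_in_iff)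
      then obtain M where "lit_gt gt M ?E" "count C M > 0"
        using gtC unfolding cls_gt_def multiset_gt_iff by (metis less_nat_zero_code neq0_conv)
      moreover from this(2) have "M \<in># C" by simp
      ultimately show ?thesis
        using lc_gt_rule_lit_gt[of Var \<sigma> M] lc_gt_rule_lit_gt[of \<sigma> Var M] lit[of M] gl \<sigma>
        by (intro dominated[of M]) auto
    next
      case True
      then obtain B where B: "C = add_mset ?E B" by (metis mset_add)
      \<comment> \<open>Otherwise \<open>C\<close> would be the instantiated rule itself and could
        not exceed it. Hence the literals of \<open>C\<close> enter in identity form.\<close>
      have "B \<noteq> {#}" using gtC by (auto simp: B cls_gt_def multiset_gt_irrefl)
      note M_cc = M_cc_not_single[OF this]
      have "lcl (?E \<cdot>l \<sigma>) Var = ?P \<or> lc_gt tc_gt (lcl (?E \<cdot>l \<sigma>) Var) ?P"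
        using lc_ge_rule_instance[of \<sigma> Var ?E] lit[OF True] gl \<sigma> by simp
      then show ?thesis
      proof
        assume eq: "lcl (?E \<cdot>l \<sigma>) Var = ?P"
        \<comment> \<open>In a tie, \<open>?P\<close> is itself an element of the multiset of
          \<open>C\<close>, and the further literals in \<open>B\<close> make the inclusion
          proper.\<close>
        have "count {#?P#} x \<le> count (M_cc (C, \<sigma>)) x" for x
          using eq by (simp add: B M_cc)
        moreover have "M_cc (C, \<sigma>) \<noteq> {#?P#}"
          using \<open>B \<noteq> {#}\<close> eq by (simp add: B M_cc)
        ultimately show ?thesis
          by (auto simp: cc_gt_def M_cc_single multiset_gt_iff not_less[symmetric])
      next
        assume "lc_gt tc_gt (lcl (?E \<cdot>l \<sigma>) Var) ?P"
        then show ?thesis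
          unfolding cc_gt_def
          by (intro multiset_gt_dominate[of "lcl (?E \<cdot>l \<sigma>) Var"])
            (auto simp: B M_cc M_cc_single lc_gt_irrefl)
      qed
    qed
  qed
qed

lemma closure_redundant_rewrite:
  assumes C: "C \<in> clauses F" and rep: "replace_in_cls (l \<cdot> \<theta>) (r \<cdot> \<theta>) C C'"
    and large: "cls_gt gt C {#l \<cdot> \<theta> \<approx> r \<cdot> \<theta>#} \<or> l \<cdot> \<theta> \<sqsupset> l"
  shows "closure_redundant F tc_gt C {{#l \<approx> r#}, C'}"
  unfolding closure_redundant_def
proof (intro allI impI)
  fix \<sigma> assume \<sigma>: "is_subst F \<sigma>" and ground: "vars_cls (C \<cdot>c \<sigma>) = {}"
  let ?\<eta> = "\<lambda>x. \<theta> x \<cdot> \<sigma>"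
  let ?G = "{({#l \<approx> r#}, ?\<eta>), (C', \<sigma>)}"
  have lr: "l \<cdot> \<theta> \<in> trms F" "r \<cdot> \<theta> \<in> trms F" using l r \<theta> by (auto intro: subst_in_trms)
  \<comment> \<open>The rewritten clause and the right-hand side of the rule gain no variables, so
    \<sigma> grounds them as well.\<close>
  have vars: "vars_trm (r \<cdot> \<theta>) \<subseteq> vars_trm (l \<cdot> \<theta>)" using gt_vars[OF l_gt_r lr] .
  obtain L L' B where L: "replace_in_lit (l \<cdot> \<theta>) (r \<cdot> \<theta>) L L'"
    and CB: "C = add_mset L B" "C' = add_mset L' B"
    using rep by cases
  have "vars_cls C' \<subseteq> vars_cls C" using replace_in_lit_vars[OF L vars] by (auto simp: CB vars_cls_def)
  then have "vars_cls (C' \<cdot>c \<sigma>) = {}" using ground by (auto simp: vars_subst_cls)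
  moreover have "vars_trm (l \<cdot> \<theta>) \<subseteq> vars_cls C"
    using L vars_subset_plug[of "l \<cdot> \<theta>"] by cases (fastforce simp: CB vars_cls_def vars_lit_def)+
  then have "vars_trm (l \<cdot> \<theta> \<cdot> \<sigma>) = {}" "vars_trm (r \<cdot> \<theta> \<cdot> \<sigma>) = {}"
    using ground vars unfolding vars_subst_cls vars_subst_trm[of _ \<sigma>] by blast+
  then have "vars_cls ({#l \<approx> r#} \<cdot>c ?\<eta>) = {}"
    by (simp add: vars_cls_def subst_cls_def vars_lit_def subst_trm_comp)
  ultimately have "?G \<subseteq> ground_closures_of F {{#l \<approx> r#}, C'}"
    using \<sigma> \<theta> by (auto simp: ground_closures_of_def intro: is_subst_comp)
  moreover have "{D \<cdot>c \<rho> | D \<rho>. (D, \<rho>) \<in> ?G} = {{#l \<cdot> \<theta> \<cdot> \<sigma> \<approx> r \<cdot> \<theta> \<cdot> \<sigma>#}, C' \<cdot>c \<sigma>}"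
    by (simp add: subst_cls_def subst_trm_comp conj_disj_distribL ex_disj_distrib Collect_disj_eq) blast
  then have "entails F {D \<cdot>c \<rho> | D \<rho>. (D, \<rho>) \<in> ?G} (C \<cdot>c \<sigma>)"
    using entails_ground_rewrite[OF rep] by simp
  moreover have "\<forall>d\<in>?G. cc_gt tc_gt (C, \<sigma>) d"
    using cc_gt_rule[OF C \<sigma> ground rep large] cc_gt_replace[OF rep l_gt_r lr(2) C \<sigma> ground] by simp
  ultimately show "\<exists>G \<subseteq> ground_closures_of F {{#l \<approx> r#}, C'}.
    entails F {D \<cdot>c \<rho> | D \<rho>. (D, \<rho>) \<in> G} (C \<cdot>c \<sigma>) \<and> (\<forall>d\<in>G. cc_gt tc_gt (C, \<sigma>) d)"
    by blast
qed

end

end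

theorem theorem2:
  fixes F :: "('f \<times> nat) set"
    and gt :: "('f, 'v) trm \<Rightarrow> ('f, 'v) trm \<Rightarrow> bool"
    and tc_gt :: "('f, 'v) trm_closure \<Rightarrow> ('f, 'v) trm_closure \<Rightarrow> bool"
    and l r :: "('f, 'v) trm" and \<theta> :: "('f, 'v) subst" and C C' :: "('f, 'v) clause"
  assumes "reduction_ordering F gt" and "totalp_on (ground_trms F) gt"
    and "closure_ordering F gt tc_gt"
    and "l \<in> trms F" and "r \<in> trms F" and "is_subst F \<theta>" and "C \<in> clauses F"
    and "replace_in_cls (l \<cdot> \<theta>) (r \<cdot> \<theta>) C C'"
    and "gt (l \<cdot> \<theta>) (r \<cdot> \<theta>)"
    and "cls_gt gt C {#l \<cdot> \<theta> \<approx> r \<cdot> \<theta>#} \<or> l \<cdot> \<theta> \<sqsupset> l"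
  shows "entails F {{#l \<approx> r#}, C} C' \<and> closure_redundant F tc_gt C {{#l \<approx> r#}, C'}"
proof -
  interpret closure_orderings F gt tc_gt
    using assms(1-3) by unfold_locales
  show ?thesis
    using entails_rewrite[OF assms(6,8)]
      closure_redundant_rewrite[OF assms(4,5,6,9,7,8,10)] by blast
qed

end
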